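(* Let $\mathsf{C}$ be a Mal'tsev category. Then any $\mathsf{Ord}$-enrichment of $\mathsf{C}$ (i.e. any $\mathsf{Ord}$-category whose underlying ordinary category is $\mathsf{C}$) is an $\mathsf{Ord}$-Mal'tsev category.
   Context: Ordinary notions: for an arbitrary category $\mathsf{C}$ (no limits assumed), an ordinary relation from $X$ to $Y$ is a span $X\stackrel{d_1}{\leftarrow}D\stackrel{d_2}{\to}Y$ with $(d_1,d_2)$ jointly monomorphic. For $x\colon A\to X$, $y\colon A\to Y$, write $(x,y)\in_AD$ if there is $c\colon A\to D$ with $d_1c=x$, $d_2c=y$. $D$ is difunctional if for every object $A$ and all $x,u\colon A\to X$, $y,v\colon A\to Y$: $(x,y)\in_AD$, $(u,y)\in_AD$ and $(u,v)\in_AD$ imply $(x,v)\in_AD$. $\mathsf{C}$ is a Mal'tsev category when every ordinary relation in $\mathsf{C}$ is difunctional. Enriched notions: an $\mathsf{Ord}$-category $\mathbb{C}$ is a category in which every hom-set carries a preorder $\preccurlyeq$ (reflexive, transitive) preserved by composition on both sides. A relation from $X$ to $Y$ in $\mathbb{C}$ is a span $X\stackrel{r_1}{\leftarrow}R\stackrel{r_2}{\to}Y$ which is jointly ff-monomorphic, i.e. jointly monomorphic and such that $r_1a\preccurlyeq r_1a'$ and $r_2a\preccurlyeq r_2a'$ imply $a\preccurlyeq a'$. It is an ideal, written $R\colon X\looparrowright Y$, if for all $x,x'\colon A\to X$, $y,y'\colon A\to Y$: $x'\preccurlyeq x$, $(x,y)\in_AR$ and $y\preccurlyeq y'$ imply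 $(x',y')\in_AR$. $\mathbb{C}$ is an $\mathsf{Ord}$-Mal'tsev category when every ideal $D\colon X\looparrowright Y$ satisfies: for all $x,u,u'\colon A\to X$ and $y,y',v\colon A\to Y$, if $(x,y)\in_AD$, $y\preccurlyeq y'$, $(u,y')\in_AD$, $u\preccurlyeq u'$ and $(u',v)\in_AD$, then $(x,v)\in_AD$. *)

theory Defs
  imports Main
begin

section \<open>Categories\<close>

record ('o, 'm) cat =
  Obj  :: "'o set"
  Arr  :: "'m set"
  Dom  :: "'m \<Rightarrow> 'o"
  Cod  :: "'m \<Rightarrow> 'o"
  Idt  :: "'o \<Rightarrow> 'm"
  Comp :: "'m \<Rightarrow> 'm \<Rightarrow> 'm"  (infixr "\<cdot>\<index>" 70)

text \<open>Composition is written in the usual order: \<open>g \<cdot>\<^bsub>C\<^esub> f\<close> is \<open>f\<close> followed by \<open>g\<close>.\<close>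

definition hom :: "('o, 'm, 'z) cat_scheme \<Rightarrow> 'o \<Rightarrow> 'o \<Rightarrow> 'm set"
  where "hom C X Y = {f \<in> Arr C. Dom C f = X \<and> Cod C f = Y}"

locale category =
  fixes C :: "('o, 'm, 'z) cat_scheme" (structure)
  assumes Dom_Obj: "f \<in> Arr C \<Longrightarrow> Dom C f \<in> Obj C"
    and Cod_Obj: "f \<in> Arr C \<Longrightarrow> Cod C f \<in> Obj C"
    and Idt_hom: "X \<in> Obj C \<Longrightarrow> Idt C X \<in> hom C X X"
    and Comp_hom: "\<lbrakk>f \<in> hom C X Y; g \<in> hom C Y Z\<rbrakk> \<Longrightarrow> g \<cdot> f \<in> hom C X Z"
    and Comp_Idt_right: "f \<in> hom C X Y \<Longrightarrow> f \<cdot> Idt C X = f"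
    and Comp_Idt_left: "f \<in> hom C X Y \<Longrightarrow> Idt C Y \<cdot> f = f"
    and Comp_assoc: "\<lbrakk>f \<in> hom C W X; g \<in> hom C X Y; h \<in> hom C Y Z\<rbrakk>
          \<Longrightarrow> (h \<cdot> g) \<cdot> f = h \<cdot> (g \<cdot> f)"


section \<open>Ordinary relations and Mal'tsev categories\<close>

text \<open>A span from \<open>X\<close> to \<open>Y\<close> is given by its vertex \<open>D\<close> and its legs
  \<open>d\<^sub>1 \<in> hom C D X\<close>, \<open>d\<^sub>2 \<in> hom C D Y\<close>.\<close>

definition jointly_monic :: "('o, 'm, 'z) cat_scheme \<Rightarrow> 'o \<Rightarrow> 'm \<Rightarrow> 'm \<Rightarrow> bool"
  where "jointly_monic C D d1 d2 \<longleftrightarrow>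
    (\<forall>A \<in> Obj C. \<forall>a \<in> hom C A D. \<forall>a' \<in> hom C A D.
       d1 \<cdot>\<^bsub>C\<^esub> a = d1 \<cdot>\<^bsub>C\<^esub> a' \<and> d2 \<cdot>\<^bsub>C\<^esub> a = d2 \<cdot>\<^bsub>C\<^esub> a' \<longrightarrow> a = a')"

definition ordinary_relation ::
    "('o, 'm, 'z) cat_scheme \<Rightarrow> 'o \<Rightarrow> 'o \<Rightarrow> 'o \<Rightarrow> 'm \<Rightarrow> 'm \<Rightarrow> bool"
  where "ordinary_relation C X Y D d1 d2 \<longleftrightarrow>
    d1 \<in> hom C D X \<and> d2 \<in> hom C D Y \<and> jointly_monic C D d1 d2"

text \<open>\<open>rel_mem C A D d\<^sub>1 d\<^sub>2 x y\<close> stands for \<open>(x, y) \<in>\<^sub>A D\<close>.\<close>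

definition rel_mem ::
    "('o, 'm, 'z) cat_scheme \<Rightarrow> 'o \<Rightarrow> 'o \<Rightarrow> 'm \<Rightarrow> 'm \<Rightarrow> 'm \<Rightarrow> 'm \<Rightarrow> bool"
  where "rel_mem C A D d1 d2 x y \<longleftrightarrow>
    (\<exists>c \<in> hom C A D. d1 \<cdot>\<^bsub>C\<^esub> c = x \<and> d2 \<cdot>\<^bsub>C\<^esub> c = y)"

definition difunctional ::
    "('o, 'm, 'z) cat_scheme \<Rightarrow> 'o \<Rightarrow> 'o \<Rightarrow> 'o \<Rightarrow> 'm \<Rightarrow> 'm \<Rightarrow> bool"
  where "difunctional C X Y D d1 d2 \<longleftrightarrow>
    (\<forall>A \<in> Obj C. \<forall>x \<in> hom C A X. \<forall>u \<in> hom C A X. \<forall>y \<in> hom C A Y. \<forall>v \<in> hom C A Y.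
       rel_mem C A D d1 d2 x y \<and> rel_mem C A D d1 d2 u y \<and> rel_mem C A D d1 d2 u v
       \<longrightarrow> rel_mem C A D d1 d2 x v)"

locale maltsev_category = category +
  assumes difunctional:
    "ordinary_relation C X Y D d1 d2 \<Longrightarrow> difunctional C X Y D d1 d2"


section \<open>Preorder-enriched categories\<close>

text \<open>The field \<open>Leq\<close> collects the orders of all hom-sets; its value on arrows that are not
  parallel is irrelevant and is never used.\<close>

record ('o, 'm) ord_cat = "('o, 'm) cat" +
  Leq :: "'m \<Rightarrow> 'm \<Rightarrow> bool"  (infix "\<preceq>\<index>" 50)

locale ord_category = category C
  for C :: "('o, 'm, 'z) ord_cat_scheme" (structure) +
  assumes Leq_refl: "reflp_on (hom C X Y) (Leq C)"
    and Leq_trans: "transp_on (hom C X Y) (Leq C)"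
    and Comp_mono_right: "\<lbrakk>f \<in> hom C X Y; f' \<in> hom C X Y; f \<preceq> f'; g \<in> hom C Y Z\<rbrakk>
          \<Longrightarrow> g \<cdot> f \<preceq> g \<cdot> f'"
    and Comp_mono_left: "\<lbrakk>f \<in> hom C X Y; g \<in> hom C Y Z; g' \<in> hom C Y Z; g \<preceq> g'\<rbrakk>
          \<Longrightarrow> g \<cdot> f \<preceq> g' \<cdot> f"

definition underlying_cat :: "('o, 'm) ord_cat \<Rightarrow> ('o, 'm) cat"
  where "underlying_cat C = cat.truncate C"

definition jointly_ff_monic :: "('o, 'm, 'z) ord_cat_scheme \<Rightarrow> 'o \<Rightarrow> 'm \<Rightarrow> 'm \<Rightarrow> bool"
  where "jointly_ff_monic C R r1 r2 \<longleftrightarrow>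
    jointly_monic C R r1 r2 \<and>
    (\<forall>A \<in> Obj C. \<forall>a \<in> hom C A R. \<forall>a' \<in> hom C A R.
       r1 \<cdot>\<^bsub>C\<^esub> a \<preceq>\<^bsub>C\<^esub> r1 \<cdot>\<^bsub>C\<^esub> a' \<and> r2 \<cdot>\<^bsub>C\<^esub> a \<preceq>\<^bsub>C\<^esub> r2 \<cdot>\<^bsub>C\<^esub> a' \<longrightarrow> a \<preceq>\<^bsub>C\<^esub> a')"

definition ord_relation ::
    "('o, 'm, 'z) ord_cat_scheme \<Rightarrow> 'o \<Rightarrow> 'o \<Rightarrow> 'o \<Rightarrow> 'm \<Rightarrow> 'm \<Rightarrow> bool"
  where "ord_relation C X Y R r1 r2 \<longleftrightarrow>
    r1 \<in> hom C R X \<and> r2 \<in> hom C R Y \<and> jointly_ff_monic C R r1 r2"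

definition ideal ::
    "('o, 'm, 'z) ord_cat_scheme \<Rightarrow> 'o \<Rightarrow> 'o \<Rightarrow> 'o \<Rightarrow> 'm \<Rightarrow> 'm \<Rightarrow> bool"
  where "ideal C X Y R r1 r2 \<longleftrightarrow>
    ord_relation C X Y R r1 r2 \<and>
    (\<forall>A \<in> Obj C. \<forall>x \<in> hom C A X. \<forall>x' \<in> hom C A X. \<forall>y \<in> hom C A Y. \<forall>y' \<in> hom C A Y.
       x' \<preceq>\<^bsub>C\<^esub> x \<and> rel_mem C A R r1 r2 x y \<and> y \<preceq>\<^bsub>C\<^esub> y' \<longrightarrow> rel_mem C A R r1 r2 x' y')"

locale ord_maltsev_category = ord_category +
  assumes ord_difunctional:
    "\<lbrakk>ideal C X Y D d1 d2; A \<in> Obj C;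
      x \<in> hom C A X; u \<in> hom C A X; u' \<in> hom C A X;
      y \<in> hom C A Y; y' \<in> hom C A Y; v \<in> hom C A Y;
      rel_mem C A D d1 d2 x y; y \<preceq> y'; rel_mem C A D d1 d2 u y'; u \<preceq> u';
      rel_mem C A D d1 d2 u' v\<rbrakk>
     \<Longrightarrow> rel_mem C A D d1 d2 x v"

end

theory Submission
  imports Defs
begin

text \<open>The two inequalities in the enriched difunctionality condition are absorbed by the ideal
  property: \<open>y \<preceq> y'\<close> turns \<open>(x, y) \<in>\<^sub>A D\<close> into \<open>(x, y') \<in>\<^sub>A D\<close>, and \<open>u \<preceq> u'\<close> turns
  \<open>(u', v) \<in>\<^sub>A D\<close> into \<open>(u, v) \<in>\<^sub>A D\<close>. What remains, namely that \<open>(x, y')\<close>, \<open>(u, y')\<close> and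
  \<open>(u, v)\<close> belong to \<open>D\<close>, are the premises of ordinary difunctionality. It applies because a jointly
  ff-monomorphic span is in particular jointly monomorphic, hence an ordinary relation in the
  underlying category, which is Mal'tsev.\<close>

lemma hom_underlying_cat: "hom (underlying_cat C) X Y = hom C X Y"
  by (simp add: underlying_cat_def cat.truncate_def hom_def)

lemma rel_mem_underlying_cat:
  "rel_mem (underlying_cat C) A D d1 d2 x y \<longleftrightarrow> rel_mem C A D d1 d2 x y"
  unfolding rel_mem_def hom_underlying_cat
  by (simp add: underlying_cat_def cat.truncate_def)

lemma ordinary_relation_underlying_cat:
  "ordinary_relation (underlying_cat C) X Y D d1 d2 \<longleftrightarrow> ordinary_relation C X Y D d1 d2"
  unfolding ordinary_relation_def jointly_monic_def hom_underlying_cat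
  by (simp add: underlying_cat_def cat.truncate_def)

lemma difunctional_underlying_cat:
  "difunctional (underlying_cat C) X Y D d1 d2 \<longleftrightarrow> difunctional C X Y D d1 d2"
  unfolding difunctional_def hom_underlying_cat rel_mem_underlying_cat
  by (simp add: underlying_cat_def cat.truncate_def)

lemma ideal_imp_ordinary_relation:
  "ideal C X Y D d1 d2 \<Longrightarrow> ordinary_relation C X Y D d1 d2"
  by (simp add: ideal_def ord_relation_def jointly_ff_monic_def ordinary_relation_def)

lemma ideal_closed:
  assumes "ideal C X Y D d1 d2" "A \<in> Obj C"
    and "x \<in> hom C A X" "x' \<in> hom C A X" "y \<in> hom C A Y" "y' \<in> hom C A Y"
    and "x' \<preceq>\<^bsub>C\<^esub> x" "rel_mem C A D d1 d2 x y" "y \<preceq>\<^bsub>C\<^esub> y'"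
  shows "rel_mem C A D d1 d2 x' y'"
  using assms unfolding ideal_def by blast

lemma (in ord_category) Leq_reflI: "f \<in> hom C X Y \<Longrightarrow> f \<preceq> f"
  using Leq_refl by (rule reflp_onD)

theorem proposition5p4:
  fixes C :: "('o, 'm) cat" and CC :: "('o, 'm) ord_cat"
  assumes "maltsev_category C"
    and "ord_category CC"
    and "underlying_cat CC = C"
  shows "ord_maltsev_category CC"
proof -
  interpret ord_category CC by fact
  show ?thesis
  proof unfold_locales
    fix X Y D d1 d2 A x u u' y y' v
    assume ideal: "ideal CC X Y D d1 d2" and A: "A \<in> Obj CC"
      and x: "x \<in> hom CC A X" and u: "u \<in> hom CC A X" and u': "u' \<in> hom CC A X"
      and y: "y \<in> hom CC A Y" and y': "y' \<in> hom CC A Y" and v: "v \<in> hom CC A Y"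
      and xy: "rel_mem CC A D d1 d2 x y" and le_y: "y \<preceq>\<^bsub>CC\<^esub> y'"
      and uy': "rel_mem CC A D d1 d2 u y'" and le_u: "u \<preceq>\<^bsub>CC\<^esub> u'"
      and u'v: "rel_mem CC A D d1 d2 u' v"
    have "rel_mem CC A D d1 d2 x y'"
      using ideal_closed[OF ideal A x x y y' Leq_reflI[OF x] xy le_y] .
    moreover have "rel_mem CC A D d1 d2 u v"
      using ideal_closed[OF ideal A u' u v v le_u u'v Leq_reflI[OF v]] .
    moreover have "difunctional CC X Y D d1 d2"
      using maltsev_category.difunctional[OF assms(1)] ideal_imp_ordinary_relation[OF ideal]
      by (simp add: assms(3)[symmetric] ordinary_relation_underlying_cat
          difunctional_underlying_cat)
    ultimately show "rel_mem CC A D d1 d2 x v"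
      using A x u y' v uy' unfolding difunctional_def by blast
  qed
qed

end
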